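(* A smooth vector field $\begin{pmatrix}u \\ v\end{pmatrix}\in\mathfrak{X}(\mathbb{O}^2)$, with $u,v\in C^\infty(\mathbb{O}^2,\mathbb{O})$, is tangent to the leaves of the singular octonionic Hopf leaf decomposition $\mathcal{L}_{OH}$ if and only if, for all $(x,y)\in\mathbb{O}^2\cong\mathbb{R}^{16}$, $$u\cdot\overline{y}+x\cdot\overline{v}=0\qquad\text{and}\qquad \langle x,u\rangle=\langle y,v\rangle=0,$$ where $u$ and $v$ are evaluated at $(x,y)$.
   Context: $\mathbb{O}\cong\mathbb{R}^8$ denotes the octonions: the real unital non-associative algebra with orthonormal basis $e_0=1,e_1,\dots,e_7$ and $e_i\cdot e_j=-\delta_{ij}1+\sum_k\epsilon_{ijk}e_k$ for $1\le i,j\le 7$, where $\epsilon_{ijk}$ is completely antisymmetric, equal to $1$ for $ijk\in\{123,145,176,246,257,347,365\}$, and $0$ for all triples that are not permutations of these; $\langle\cdot,\cdot\rangle$, $\|\cdot\|$ are the Euclidean inner product and norm and $\overline{a}=2\langle a,1\rangle 1-a$ is conjugation. $\mathcal{L}_{OH}$: for $m\in\mathbb{O}$ let $l_m=\{(x,m\cdot x):x\in\mathbb{O}\}$ and let $l_\infty=\{(0,x):x\in\mathbb{O}\}$. For $r>0$ let $\mathrm{S}(r)=\{(x,y)\in\mathbb{O}^2:\|x\|^2+\|y\|^2=r^2\}$. The leaves of $\mathcal{L}_{OH}$ are $l_m\cap \mathrm{S}(r)$, $l_\infty\cap \mathrm{S}(r)$ ($m\in\mathbb{O}$, $r>0$),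 and the origin. A vector field is tangent to the leaves if at each point it lies in the tangent space of the leaf through that point. The pair $\begin{pmatrix}u \\ v\end{pmatrix}$ denotes the vector field $\sum_i\left(u^i\frac{\partial}{\partial x^i}+v^i\frac{\partial}{\partial y^i}\right)$, with $x^i,y^i,u^i,v^i$ ($i=0,\dots,7$) the components in the basis $e_i$. *)

theory Defs
  imports "HOL-Analysis.Analysis"
begin

section \<open>Octonions\<close>

text \<open>
  The octonions are the Euclidean space of dimension 8, with coordinates indexed by the
  eight-element numeral type, whose elements are 0, ..., 7.  The type class constants
  \<open>1\<close> and \<open>*\<close> on this type are componentwise and are \<^emph>\<open>not\<close> the octonion unit and product;
  these are \<open>oct_e 0\<close> and \<open>oct_mult\<close>.
\<close>

type_synonym octonion = "real ^ 8"

definition oct_e :: "8 \<Rightarrow> octonion" where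
  "oct_e i = axis i 1"

definition oct_triples :: "(8 \<times> 8 \<times> 8) set" where
  "oct_triples = {(1,2,3), (1,4,5), (1,7,6), (2,4,6), (2,5,7), (3,4,7), (3,6,5)}"

text \<open>The completely antisymmetric symbol: even permutations of a triple give 1, odd ones -1.\<close>

definition oct_eps :: "8 \<Rightarrow> 8 \<Rightarrow> 8 \<Rightarrow> real" where
  "oct_eps i j k =
    (if (i,j,k) \<in> oct_triples \<or> (j,k,i) \<in> oct_triples \<or> (k,i,j) \<in> oct_triples then 1
     else if (j,i,k) \<in> oct_triples \<or> (i,k,j) \<in> oct_triples \<or> (k,j,i) \<in> oct_triples then - 1
     else 0)"

definition oct_basis_mult :: "8 \<Rightarrow> 8 \<Rightarrow> octonion" where
  "oct_basis_mult i j =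
    (if i = 0 then oct_e j
     else if j = 0 then oct_e i
     else (if i = j then - oct_e 0 else 0) + (\<Sum>k\<in>UNIV - {0}. oct_eps i j k *\<^sub>R oct_e k))"

definition oct_mult :: "octonion \<Rightarrow> octonion \<Rightarrow> octonion" (infixl "\<cdot>\<^sub>O" 70) where
  "a \<cdot>\<^sub>O b = (\<Sum>i\<in>UNIV. \<Sum>j\<in>UNIV. (a $ i * b $ j) *\<^sub>R oct_basis_mult i j)"

definition oct_cnj :: "octonion \<Rightarrow> octonion" where
  "oct_cnj a = (2 * (a \<bullet> oct_e 0)) *\<^sub>R oct_e 0 - a"

section \<open>Smooth maps and tangent spaces\<close>

text \<open>
  The class C^k on an open set \<open>S\<close> of a finite-dimensional space: \<open>f\<close> is differentiable on \<open>S\<close>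
  and all its directional derivatives are of class C^(k-1).
\<close>

primrec Ck_on :: "nat \<Rightarrow> 'a::euclidean_space set \<Rightarrow> ('a \<Rightarrow> 'b::euclidean_space) \<Rightarrow> bool" where
  "Ck_on 0 S f \<longleftrightarrow> continuous_on S f"
| "Ck_on (Suc k) S f \<longleftrightarrow>
     (\<forall>x\<in>S. f differentiable (at x)) \<and>
     (\<forall>w. Ck_on k S (\<lambda>x. frechet_derivative f (at x) w))"

definition smooth_on :: "'a::euclidean_space set \<Rightarrow> ('a \<Rightarrow> 'b::euclidean_space) \<Rightarrow> bool" where
  "smooth_on S f \<longleftrightarrow> (\<forall>k. Ck_on k S f)"

text \<open>
  For an embedded submanifold \<open>L\<close> of a Euclidean space, the tangent space at \<open>p\<close> is the set of
  velocities at \<open>p\<close> of smooth curves in \<open>L\<close>, viewed as vectors of the ambient space.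
\<close>

definition tangent_space :: "'a::euclidean_space set \<Rightarrow> 'a \<Rightarrow> 'a set" where
  "tangent_space L p =
    {w. \<exists>\<epsilon>>0. \<exists>\<gamma> :: real \<Rightarrow> 'a.
          smooth_on {-\<epsilon><..<\<epsilon>} \<gamma> \<and> \<gamma> ` {-\<epsilon><..<\<epsilon>} \<subseteq> L \<and> \<gamma> 0 = p \<and>
          (\<gamma> has_vector_derivative w) (at 0)}"

text \<open>
  Intended for a family \<open>\<L>\<close> of submanifolds that partitions the space, so that there is exactly
  one leaf \<open>L\<close> through each point \<open>p\<close>.
\<close>

definition tangent_to_leaves ::
    "'a::euclidean_space set set \<Rightarrow> ('a \<Rightarrow> 'a) \<Rightarrow> bool" where
  "tangent_to_leaves \<L> X \<longleftrightarrow> (\<forall>p. \<forall>L\<in>\<L>. p \<in> L \<longrightarrow> X p \<in> tangent_space L p)"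

section \<open>The singular octonionic Hopf leaf decomposition\<close>

definition oct_line :: "octonion \<Rightarrow> (octonion \<times> octonion) set" where
  "oct_line m = {(x, m \<cdot>\<^sub>O x) | x. True}"

definition oct_line_inf :: "(octonion \<times> octonion) set" where
  "oct_line_inf = {(0, x) | x. True}"

definition oct_sphere :: "real \<Rightarrow> (octonion \<times> octonion) set" where
  "oct_sphere r = {(x, y). (norm x)\<^sup>2 + (norm y)\<^sup>2 = r\<^sup>2}"

definition L_OH :: "(octonion \<times> octonion) set set" where
  "L_OH = {oct_line m \<inter> oct_sphere r | m r. r > 0}
        \<union> {oct_line_inf \<inter> oct_sphere r | r. r > 0}
        \<union> {{(0, 0)}}"

end

theory Submission
  imports Defs
begin

text \<open>
  A nontrivial leaf is the intersection of a linear subspace \<open>V\<close> with a sphere, so its tangent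
  space at \<open>p\<close> consists of the vectors of \<open>V\<close> orthogonal to \<open>p\<close>; conversely, such a vector is
  the velocity of a great circle. On the leaf \<open>y = m x\<close> with \<open>x \<noteq> 0\<close>, tangency of \<open>(u, v)\<close> says
  \<open>v = m u\<close> and \<open>\<langle>x, u\<rangle> + \<langle>y, v\<rangle> = 0\<close>. Because \<open>\<langle>m x, m u\<rangle> = |m|^2 \<langle>x, u\<rangle>\<close>, both inner products
  vanish, and polarizing \<open>x (cnj x c) = |x|^2 c\<close> yields
  \<open>u cnj y = u (cnj x cnj m) = - x (cnj u cnj m) = - x cnj (m u)\<close>. Since \<open>x\<close> can be cancelled,
  \<open>v = m u\<close> is then equivalent to \<open>u cnj y + x cnj v = 0\<close>.
\<close>

section \<open>Octonion algebra\<close>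

lemma UNIV_8: "(UNIV :: 8 set) = {0,1,2,3,4,5,6,7}"
proof -
  have "card {0,1,2,3,4,5,6,7::8} = CARD(8)" by simp
  then show ?thesis by (metis card_subset_eq finite subset_UNIV)
qed

lemma sum_8: "(\<Sum>i\<in>UNIV. f i) = f 0 + f 1 + f 2 + f 3 + f 4 + f 5 + f 6 + f (7::8)"
  for f :: "8 \<Rightarrow> 'a::comm_monoid_add"
  unfolding UNIV_8 by (simp add: add.assoc)

lemma all_8: "(\<forall>i::8. P i) \<longleftrightarrow> P 0 \<and> P 1 \<and> P 2 \<and> P 3 \<and> P 4 \<and> P 5 \<and> P 6 \<and> P 7"
  by (metis UNIV_8 UNIV_I empty_iff insert_iff)

lemma oct_basis_mult_nth:
  "oct_basis_mult i j $ k =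
    (if i = 0 then of_bool (j = k) else if j = 0 then of_bool (i = k)
     else if k = 0 then - of_bool (i = j) else oct_eps i j k)"
proof -
  have "(\<Sum>l\<in>UNIV - {0}. oct_eps i j l *\<^sub>R oct_e l) $ k = (\<Sum>l\<in>UNIV - {0}. if l = k then oct_eps i j l else 0)"
    by (simp add: oct_e_def axis_def if_distrib cong: if_cong)
  then show ?thesis
    by (auto simp: oct_basis_mult_def oct_e_def axis_def)
qed

lemma oct_mult_nth: "(a \<cdot>\<^sub>O b) $ k = (\<Sum>i\<in>UNIV. \<Sum>j\<in>UNIV. a $ i * b $ j * oct_basis_mult i j $ k)"
  by (simp add: oct_mult_def)

lemmas oct_mult_nth_simps = oct_mult_nth sum_8 oct_basis_mult_nth oct_eps_def oct_triples_def

text \<open>The eight expanded components turn octonion identities into polynomial identities in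
  real coordinates, so no associativity is ever invoked.\<close>

lemma oct_mult_0: "(a \<cdot>\<^sub>O b) $ 0 = a$0*b$0 - a$1*b$1 - a$2*b$2 - a$3*b$3 - a$4*b$4 - a$5*b$5 - a$6*b$6 - a$7*b$7"
  by (simp add: oct_mult_nth_simps)

lemma oct_mult_1: "(a \<cdot>\<^sub>O b) $ 1 = a$0*b$1 + a$1*b$0 + (a$2*b$3 - a$3*b$2) + (a$4*b$5 - a$5*b$4) + (a$7*b$6 - a$6*b$7)"
  by (simp add: oct_mult_nth_simps)

lemma oct_mult_2: "(a \<cdot>\<^sub>O b) $ 2 = a$0*b$2 + a$2*b$0 + (a$3*b$1 - a$1*b$3) + (a$4*b$6 - a$6*b$4) + (a$5*b$7 - a$7*b$5)"
  by (simp add: oct_mult_nth_simps)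

lemma oct_mult_3: "(a \<cdot>\<^sub>O b) $ 3 = a$0*b$3 + a$3*b$0 + (a$1*b$2 - a$2*b$1) + (a$4*b$7 - a$7*b$4) + (a$6*b$5 - a$5*b$6)"
  by (simp add: oct_mult_nth_simps)

lemma oct_mult_4: "(a \<cdot>\<^sub>O b) $ 4 = a$0*b$4 + a$4*b$0 + (a$5*b$1 - a$1*b$5) + (a$6*b$2 - a$2*b$6) + (a$7*b$3 - a$3*b$7)"
  by (simp add: oct_mult_nth_simps)

lemma oct_mult_5: "(a \<cdot>\<^sub>O b) $ 5 = a$0*b$5 + a$5*b$0 + (a$1*b$4 - a$4*b$1) + (a$7*b$2 - a$2*b$7) + (a$3*b$6 - a$6*b$3)"
  by (simp add: oct_mult_nth_simps)

lemma oct_mult_6: "(a \<cdot>\<^sub>O b) $ 6 = a$0*b$6 + a$6*b$0 + (a$1*b$7 - a$7*b$1) + (a$2*b$4 - a$4*b$2) + (a$5*b$3 - a$3*b$5)"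
  by (simp add: oct_mult_nth_simps)

lemma oct_mult_7: "(a \<cdot>\<^sub>O b) $ 7 = a$0*b$7 + a$7*b$0 + (a$6*b$1 - a$1*b$6) + (a$2*b$5 - a$5*b$2) + (a$3*b$4 - a$4*b$3)"
  by (simp add: oct_mult_nth_simps)

lemmas oct_mult_components =
  oct_mult_0 oct_mult_1 oct_mult_2 oct_mult_3 oct_mult_4 oct_mult_5 oct_mult_6 oct_mult_7

lemma oct_cnj_nth: "oct_cnj a $ k = (if k = 0 then a $ k else - a $ k)"
  by (auto simp: oct_cnj_def oct_e_def inner_axis) (auto simp: axis_def)

lemma oct_cnj_cnj [simp]: "oct_cnj (oct_cnj a) = a"
  by (simp add: vec_eq_iff oct_cnj_nth)

lemma oct_cnj_mult: "oct_cnj (a \<cdot>\<^sub>O b) = oct_cnj b \<cdot>\<^sub>O oct_cnj a"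
  unfolding vec_eq_iff all_8 by (simp add: oct_cnj_nth oct_mult_components algebra_simps)

lemma inner_octonion: "a \<bullet> b = a$0*b$0 + a$1*b$1 + a$2*b$2 + a$3*b$3 + a$4*b$4 + a$5*b$5 + a$6*b$6 + a$7*b$7"
  for a b :: octonion
  by (simp add: inner_vec_def sum_8)

lemma inner_oct_mult_left: "(a \<cdot>\<^sub>O b) \<bullet> c = b \<bullet> (oct_cnj a \<cdot>\<^sub>O c)"
  by (simp add: inner_octonion oct_cnj_nth oct_mult_components algebra_simps)

text \<open>A case of alternativity, checked in coordinates. It is the substitute for associativity
  in everything that follows.\<close>

lemma oct_mult_cnj_left: "a \<cdot>\<^sub>O (oct_cnj a \<cdot>\<^sub>O b) = (a \<bullet> a) *\<^sub>R b"
  unfolding vec_eq_iff all_8 by (simp add: inner_octonion oct_cnj_nth oct_mult_components algebra_simps)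

section \<open>Bilinearity, cancellation and polarization\<close>

interpretation oct_mult: bounded_bilinear oct_mult
proof -
  have "bilinear oct_mult"
    unfolding bilinear_def
    by (auto intro!: linearI simp: oct_mult_def algebra_simps sum.distrib scaleR_right.sum)
  then show "bounded_bilinear oct_mult"
    by (simp add: bilinear_conv_bounded_bilinear)
qed

lemma oct_cnj_add: "oct_cnj (a + b) = oct_cnj a + oct_cnj b"
  by (simp add: vec_eq_iff oct_cnj_nth)

lemma oct_cnj_eq_iff [simp]: "oct_cnj a = oct_cnj b \<longleftrightarrow> a = b"
  by (metis oct_cnj_cnj)

lemma oct_cnj_zero [simp]: "oct_cnj 0 = 0"
  by (simp add: vec_eq_iff oct_cnj_nth)

lemma oct_cnj_scaleR: "oct_cnj (c *\<^sub>R a) = c *\<^sub>R oct_cnj a"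
  by (simp add: vec_eq_iff oct_cnj_nth)

lemma oct_cnj_eq_0_iff [simp]: "oct_cnj a = 0 \<longleftrightarrow> a = 0"
  using oct_cnj_eq_iff[of a 0] by simp

lemma inner_oct_cnj: "oct_cnj a \<bullet> oct_cnj b = a \<bullet> b"
  by (simp add: inner_octonion oct_cnj_nth)

text \<open>Conjugation reverses products, so this is the mirror image of
  \<open>oct_mult_cnj_left\<close>.\<close>

lemma oct_mult_cnj_right: "(b \<cdot>\<^sub>O oct_cnj a) \<cdot>\<^sub>O a = (a \<bullet> a) *\<^sub>R b"
proof -
  have "oct_cnj ((b \<cdot>\<^sub>O oct_cnj a) \<cdot>\<^sub>O a) = oct_cnj ((a \<bullet> a) *\<^sub>R b)"
    using oct_mult_cnj_left[of "oct_cnj a" "oct_cnj b"]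
    by (simp add: oct_cnj_mult oct_cnj_scaleR inner_oct_cnj)
  then show ?thesis by simp
qed

text \<open>Multiplying a vanishing product on the left by \<open>oct_cnj a\<close> leaves a
  multiple of \<open>b\<close> by the squared norm of \<open>a\<close>.\<close>

lemma oct_mult_eq_0_iff: "a \<cdot>\<^sub>O b = 0 \<longleftrightarrow> a = 0 \<or> b = 0"
proof
  assume "a \<cdot>\<^sub>O b = 0"
  then have "(a \<bullet> a) *\<^sub>R b = 0"
    using oct_mult_cnj_left[of "oct_cnj a" b] by (simp add: inner_oct_cnj oct_mult.zero_right)
  then show "a = 0 \<or> b = 0" by simp
qed (auto simp: oct_mult.zero_left oct_mult.zero_right)

text \<open>The left factor \<open>a\<close> moves across the inner product as its adjoint
  \<open>oct_cnj a\<close>, where it cancels against the other \<open>a\<close> by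
  alternativity.\<close>

lemma inner_oct_mult: "(a \<cdot>\<^sub>O x) \<bullet> (a \<cdot>\<^sub>O y) = (a \<bullet> a) * (x \<bullet> y)"
  using oct_mult_cnj_left[of "oct_cnj a" y] by (simp add: inner_oct_mult_left inner_oct_cnj)

lemma oct_mult_cnj_left_polarized:
  "a \<cdot>\<^sub>O (oct_cnj b \<cdot>\<^sub>O c) + b \<cdot>\<^sub>O (oct_cnj a \<cdot>\<^sub>O c) = (2 * (a \<bullet> b)) *\<^sub>R c"
proof -
  have "(a + b) \<cdot>\<^sub>O (oct_cnj (a + b) \<cdot>\<^sub>O c) = ((a + b) \<bullet> (a + b)) *\<^sub>R c"
    by (rule oct_mult_cnj_left)
  then show ?thesis
    by (simp add: oct_cnj_add oct_mult.add_left oct_mult.add_right oct_mult_cnj_left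
        inner_add_left inner_add_right inner_commute scaleR_add_left) (simp add: algebra_simps)
qed

text \<open>Here \<open>(a, b)\<close> is a candidate tangent vector at \<open>(x, y)\<close>: the
  left side says that it lies in the line of slope \<open>m\<close> and is orthogonal to the
  position. The right side no longer mentions \<open>m\<close>.\<close>

lemma oct_line_tangent_eqs:
  assumes "x \<noteq> 0" and y: "y = m \<cdot>\<^sub>O x"
  shows "b = m \<cdot>\<^sub>O a \<and> x \<bullet> a + y \<bullet> b = 0 \<longleftrightarrow>
    a \<cdot>\<^sub>O oct_cnj y + x \<cdot>\<^sub>O oct_cnj b = 0 \<and> x \<bullet> a = 0 \<and> y \<bullet> b = 0"
proof -
  have zero: "x \<bullet> a = 0" if "b = m \<cdot>\<^sub>O a" "x \<bullet> a + y \<bullet> b = 0"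
  proof -
    have "(1 + m \<bullet> m) * (x \<bullet> a) = 0"
      using that by (simp add: y inner_oct_mult algebra_simps)
    moreover have "1 + m \<bullet> m > 0"
      by (simp add: add_pos_nonneg)
    ultimately show ?thesis by simp
  qed
  \<comment> \<open>Both sides of the claim force \<open>x\<close> and \<open>a\<close> to be
    orthogonal, so the two descriptions of \<open>b\<close> need comparing only in that
    case.\<close>
  have "a \<cdot>\<^sub>O oct_cnj y + x \<cdot>\<^sub>O oct_cnj b = 0 \<longleftrightarrow> b = m \<cdot>\<^sub>O a" if "x \<bullet> a = 0"
  proof -
    \<comment> \<open>Polarization is applied with third factor \<open>oct_cnj m\<close>; its
      right-hand side vanishes by orthogonality.\<close>
    have "a \<cdot>\<^sub>O oct_cnj y = - (x \<cdot>\<^sub>O oct_cnj (m \<cdot>\<^sub>O a))"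
      using oct_mult_cnj_left_polarized[of x a "oct_cnj m"] that
      by (simp add: y oct_cnj_mult eq_neg_iff_add_eq_0 add.commute)
    then have "a \<cdot>\<^sub>O oct_cnj y + x \<cdot>\<^sub>O oct_cnj b = x \<cdot>\<^sub>O (oct_cnj b - oct_cnj (m \<cdot>\<^sub>O a))"
      by (simp add: oct_mult.diff_right)
    with \<open>x \<noteq> 0\<close> show ?thesis by (simp add: oct_mult_eq_0_iff)
  qed
  with zero show ?thesis by auto
qed

section \<open>Tangent spaces of spherical sections of subspaces\<close>

lemma trig_curve_has_vector_derivative:
  "((\<lambda>t. cos (a * t) *\<^sub>R p + sin (a * t) *\<^sub>R q) has_vector_derivative
     cos (a * t) *\<^sub>R (a *\<^sub>R q) + sin (a * t) *\<^sub>R (- a *\<^sub>R p)) (at t)"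
  by (auto intro!: derivative_eq_intros simp: has_real_derivative_iff_has_vector_derivative[symmetric] algebra_simps)

text \<open>Differentiation keeps the form of the curve and only changes its two coefficient
  vectors; hence the induction generalizes over \<open>p\<close> and \<open>q\<close>.\<close>

lemma Ck_on_trig_curve:
  "Ck_on k S (\<lambda>t::real. cos (a * t) *\<^sub>R p + sin (a * t) *\<^sub>R q)" for p q :: "'a::euclidean_space"
proof (induction k arbitrary: p q)
  case 0
  show ?case by (auto intro!: continuous_intros)
next
  case (Suc k)
  let ?f = "\<lambda>t. cos (a * t) *\<^sub>R p + sin (a * t) *\<^sub>R q"
  note D = trig_curve_has_vector_derivative[of a p q, unfolded has_vector_derivative_def]
  have "(\<lambda>t. frechet_derivative ?f (at t) w) =
      (\<lambda>t. cos (a * t) *\<^sub>R ((w * a) *\<^sub>R q) + sin (a * t) *\<^sub>R (- (w * a) *\<^sub>R p))" for w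
    by (rule ext, subst frechet_derivative_at[OF D, symmetric]) (simp add: algebra_simps)
  then have "Ck_on k S (\<lambda>t. frechet_derivative ?f (at t) w)" for w
    by (simp only: Suc)
  then show ?case
    using D by (auto simp only: Ck_on.simps differentiable_def)
qed

lemma tangent_space_subspace_Int_sphere:
  fixes V :: "'a::euclidean_space set"
  assumes V: "subspace V" and p: "p \<in> V" "p \<noteq> 0"
  shows "tangent_space (V \<inter> sphere 0 (norm p)) p = {w \<in> V. p \<bullet> w = 0}"
proof (intro subset_antisym subsetI)
  fix w assume "w \<in> tangent_space (V \<inter> sphere 0 (norm p)) p"
  then obtain e \<gamma> where e: "e > 0" and sub: "\<gamma> ` {-e<..<e} \<subseteq> V \<inter> sphere 0 (norm p)"
    and g0: "\<gamma> 0 = p" and D: "(\<gamma> has_vector_derivative w) (at (0::real))"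
    by (auto simp: tangent_space_def)
  \<comment> \<open>The component \<open>z\<close> of the velocity normal to \<open>V\<close> is
    orthogonal to the whole curve. Differentiating gives \<open>z \<bullet> w = 0\<close>, that is
    \<open>z \<bullet> z = 0\<close>, so \<open>w\<close> lies in \<open>V\<close>.\<close>
  obtain w1 z where w1: "w1 \<in> V" and z: "\<And>x. x \<in> V \<Longrightarrow> orthogonal z x" and w: "w = w1 + z"
    using orthogonal_subspace_decomp_exists[of V w] span_eq_iff V by metis
  have "((\<lambda>t. z \<bullet> \<gamma> t) has_vector_derivative z \<bullet> w) (at 0)"
    using D by (auto intro!: derivative_eq_intros bounded_linear.has_vector_derivative[OF bounded_linear_inner_right])
  moreover have "((\<lambda>t. z \<bullet> \<gamma> t) has_vector_derivative 0) (at 0)"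
  proof (rule has_vector_derivative_transform_within_open[OF has_vector_derivative_const])
    show "open {-e<..<e}" "0 \<in> {-e<..<e}" using e by auto
    show "0 = z \<bullet> \<gamma> t" if "t \<in> {-e<..<e}" for t
    proof -
      from sub that have "\<gamma> t \<in> V" by blast
      with z show ?thesis by (simp add: orthogonal_def)
    qed
  qed
  ultimately have "z \<bullet> w = 0" by (rule vector_derivative_unique_at)
  then have "w \<in> V" using z[OF w1] w1 by (simp add: w inner_add_right orthogonal_def)
  have "((\<lambda>t. \<gamma> t \<bullet> \<gamma> t) has_vector_derivative (p \<bullet> w + w \<bullet> p)) (at 0)"
    using bounded_bilinear.has_vector_derivative[OF bounded_bilinear_inner D D] by (simp add: g0)
  moreover have "((\<lambda>t. \<gamma> t \<bullet> \<gamma> t) has_vector_derivative 0) (at 0)"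
  proof (rule has_vector_derivative_transform_within_open[OF has_vector_derivative_const])
    show "open {-e<..<e}" "0 \<in> {-e<..<e}" using e by auto
    show "p \<bullet> p = \<gamma> t \<bullet> \<gamma> t" if "t \<in> {-e<..<e}" for t
    proof -
      from sub that have "norm (\<gamma> t) = norm p" by (auto simp: image_subset_iff)
      then show ?thesis by (simp add: dot_square_norm)
    qed
  qed
  ultimately have "p \<bullet> w + w \<bullet> p = 0" by (rule vector_derivative_unique_at)
  with \<open>w \<in> V\<close> show "w \<in> {w \<in> V. p \<bullet> w = 0}" by (simp add: inner_commute)
next
  fix w assume w: "w \<in> {w \<in> V. p \<bullet> w = 0}"
  \<comment> \<open>The angular speed \<open>a\<close> makes \<open>w /\<^sub>R a\<close> as long as
    \<open>p\<close>, so the curve is a great circle. For \<open>w = 0\<close> also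
    \<open>a = 0\<close>, and the curve is constant.\<close>
  define a where "a = norm w / norm p"
  define \<gamma> where "\<gamma> = (\<lambda>t. cos (a * t) *\<^sub>R p + sin (a * t) *\<^sub>R (w /\<^sub>R a))"
  have aw: "a *\<^sub>R (w /\<^sub>R a) = w" using p by (simp add: a_def)
  have "norm (\<gamma> t) = norm p" for t
  proof (cases "w = 0")
    case False
    then have nw: "norm (w /\<^sub>R a) = norm p" using p by (simp add: a_def)
    have "\<gamma> t \<bullet> \<gamma> t = (cos (a * t))\<^sup>2 * (norm p)\<^sup>2 + (sin (a * t))\<^sup>2 * (norm (w /\<^sub>R a))\<^sup>2"
      using w unfolding power2_norm_eq_inner
      by (simp add: \<gamma>_def inner_add_left inner_add_right inner_commute power2_eq_square)
    also have "\<dots> = p \<bullet> p"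
      unfolding nw by (simp add: distrib_right[symmetric] power2_norm_eq_inner)
    finally show ?thesis by (simp add: norm_eq)
  qed (simp add: \<gamma>_def a_def)
  moreover have "\<gamma> t \<in> V" for t
    using w p V by (auto simp: \<gamma>_def intro!: subspace_add subspace_scale)
  moreover have "(\<gamma> has_vector_derivative w) (at 0)"
    using trig_curve_has_vector_derivative[of a p "w /\<^sub>R a" 0] unfolding aw by (simp add: \<gamma>_def)
  moreover have "smooth_on {-1<..<1} \<gamma>"
    unfolding smooth_on_def \<gamma>_def by (intro allI Ck_on_trig_curve)
  moreover have "\<gamma> 0 = p" by (simp add: \<gamma>_def)
  ultimately show "w \<in> tangent_space (V \<inter> sphere 0 (norm p)) p"
    unfolding tangent_space_def by (intro CollectI exI[of _ 1] conjI exI[of _ \<gamma>]) auto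
qed

text \<open>Handles the leaf at the origin, which the lemma on spherical sections excludes.\<close>

lemma tangent_space_singleton: "tangent_space {p} p = {0}"
proof (intro subset_antisym subsetI)
  fix w assume "w \<in> tangent_space {p} p"
  then obtain e \<gamma> where e: "e > 0" and sub: "\<gamma> ` {-e<..<e} \<subseteq> {p}"
    and D: "(\<gamma> has_vector_derivative w) (at (0::real))"
    by (auto simp: tangent_space_def)
  have "(\<gamma> has_vector_derivative 0) (at 0)"
  proof (rule has_vector_derivative_transform_within_open[OF has_vector_derivative_const])
    show "open {-e<..<e}" "0 \<in> {-e<..<e}" using e by auto
    show "p = \<gamma> t" if "t \<in> {-e<..<e}" for t
      using sub that by (auto simp: image_subset_iff)
  qed
  with D have "w = 0" by (rule vector_derivative_unique_at)
  then show "w \<in> {0}" by simp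
next
  fix w :: 'a assume "w \<in> {0}"
  \<comment> \<open>A constant map is the trigonometric curve with zero angular speed.\<close>
  moreover have "smooth_on {-1<..<1::real} (\<lambda>t. p)"
    using Ck_on_trig_curve[of _ _ 0 p 0] by (simp add: smooth_on_def)
  ultimately show "w \<in> tangent_space {p} p"
    unfolding tangent_space_def by (intro CollectI exI[of _ 1] conjI exI[of _ "\<lambda>t. p"]) auto
qed

section \<open>Leaves of the octonionic Hopf decomposition\<close>

lemma oct_sphere_eq: "r > 0 \<Longrightarrow> oct_sphere r = sphere 0 r"
  by (auto simp: oct_sphere_def norm_prod_def real_sqrt_unique)

lemma mem_oct_line_iff: "(x, y) \<in> oct_line m \<longleftrightarrow> y = m \<cdot>\<^sub>O x"
  by (auto simp: oct_line_def)

lemma mem_oct_line_inf_iff: "(x, y) \<in> oct_line_inf \<longleftrightarrow> x = 0"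
  by (auto simp: oct_line_inf_def)

lemma subspace_oct_line: "subspace (oct_line m)"
  by (auto simp: subspace_def oct_line_def zero_prod_def oct_mult.zero_right
      oct_mult.add_right oct_mult.scaleR_right)

lemma subspace_oct_line_inf: "subspace oct_line_inf"
  by (auto simp: subspace_def oct_line_inf_def zero_prod_def)

lemma tangent_space_Int_oct_sphere:
  assumes "subspace V" "p \<in> V \<inter> oct_sphere r" "r > 0"
  shows "tangent_space (V \<inter> oct_sphere r) p = {w \<in> V. p \<bullet> w = 0}"
proof -
  have "norm p = r" "p \<noteq> 0"
    using assms by (auto simp: oct_sphere_eq)
  with assms show ?thesis
    using tangent_space_subspace_Int_sphere[of V p] by (auto simp: oct_sphere_eq)
qed

text \<open>At the origin this would fail: there the equations hold for every \<open>(a, b)\<close>,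
  while the leaf is a single point.\<close>

lemma tangent_space_leaf_iff:
  assumes L: "L \<in> L_OH" "(x, y) \<in> L" "(x, y) \<noteq> (0, 0)"
  shows "(a, b) \<in> tangent_space L (x, y) \<longleftrightarrow>
    a \<cdot>\<^sub>O oct_cnj y + x \<cdot>\<^sub>O oct_cnj b = 0 \<and> x \<bullet> a = 0 \<and> y \<bullet> b = 0"
proof -
  from L consider (line) m r where "r > 0" "L = oct_line m \<inter> oct_sphere r"
    | (inf) r where "r > 0" "L = oct_line_inf \<inter> oct_sphere r"
    by (auto simp: L_OH_def)
  then show ?thesis
  proof cases
    case line
    then have p: "(x, y) \<in> oct_line m \<inter> oct_sphere r" using L by simp
    then have y: "y = m \<cdot>\<^sub>O x" by (simp add: mem_oct_line_iff)
    with L have "x \<noteq> 0" by (auto simp: oct_mult.zero_right)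
    have "(a, b) \<in> tangent_space L (x, y) \<longleftrightarrow> b = m \<cdot>\<^sub>O a \<and> x \<bullet> a + y \<bullet> b = 0"
      using tangent_space_Int_oct_sphere[OF subspace_oct_line p \<open>r > 0\<close>]
      by (simp add: line(2) mem_oct_line_iff)
    also note oct_line_tangent_eqs[OF \<open>x \<noteq> 0\<close> y]
    finally show ?thesis .
  next
    case inf
    then have p: "(x, y) \<in> oct_line_inf \<inter> oct_sphere r" using L by simp
    then have x: "x = 0" by (simp add: mem_oct_line_inf_iff)
    with L have "y \<noteq> 0" by simp
    have "(a, b) \<in> tangent_space L (x, y) \<longleftrightarrow> a = 0 \<and> x \<bullet> a + y \<bullet> b = 0"
      using tangent_space_Int_oct_sphere[OF subspace_oct_line_inf p \<open>r > 0\<close>]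
      by (simp add: inf(2) mem_oct_line_inf_iff)
    \<comment> \<open>With \<open>x = 0\<close> the first equation reduces to a vanishing product of
      \<open>a\<close> and \<open>oct_cnj y\<close>, hence to \<open>a = 0\<close>.\<close>
    with x \<open>y \<noteq> 0\<close> show ?thesis
      by (simp add: oct_mult.zero_left oct_mult_eq_0_iff)
  qed
qed

text \<open>Tangency would be vacuous at a point on no leaf, so deriving the equations from it
  requires a leaf through every point.\<close>

lemma leaf_through_exists: "\<exists>L\<in>L_OH. p \<in> L"
proof (cases p)
  case (Pair x y)
  have sphere: "p \<in> oct_sphere (norm p)" if "p \<noteq> 0"
    using that by (simp add: oct_sphere_eq)
  consider "p = 0" | "p \<noteq> 0" "x = 0" | "x \<noteq> 0" by blast
  then show ?thesis
  proof cases
    case 1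
    then show ?thesis by (auto simp: L_OH_def zero_prod_def)
  next
    case 2
    then have "p \<in> oct_line_inf \<inter> oct_sphere (norm p)"
      using Pair sphere by (simp add: mem_oct_line_inf_iff)
    moreover have "oct_line_inf \<inter> oct_sphere (norm p) \<in> L_OH"
      using 2 unfolding L_OH_def by fastforce
    ultimately show ?thesis by blast
  next
    case 3
    \<comment> \<open>The slope is \<open>y\<close> times the inverse of \<open>x\<close>;
      \<open>oct_mult_cnj_right\<close> justifies the cancellation.\<close>
    define m where "m = (1 / (x \<bullet> x)) *\<^sub>R (y \<cdot>\<^sub>O oct_cnj x)"
    have "y = m \<cdot>\<^sub>O x"
      using 3 by (simp add: m_def oct_mult.scaleR_left oct_mult_cnj_right)
    moreover have "p \<noteq> 0" using 3 Pair by (simp add: zero_prod_def)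
    ultimately have "p \<in> oct_line m \<inter> oct_sphere (norm p)"
      using Pair sphere by (simp add: mem_oct_line_iff)
    moreover have "oct_line m \<inter> oct_sphere (norm p) \<in> L_OH"
      using \<open>p \<noteq> 0\<close> unfolding L_OH_def by fastforce
    ultimately show ?thesis by blast
  qed
qed

text \<open>All other leaves lie on spheres of positive radius.\<close>

lemma leaf_through_zero: "L \<in> L_OH \<Longrightarrow> (0, 0) \<in> L \<Longrightarrow> L = {(0, 0)}"
  by (auto simp: L_OH_def oct_sphere_def)

section \<open>Vanishing at the origin and the characterization of tangent fields\<close>

lemma continuous_zero_along_ray:
  fixes f :: "'a::real_normed_vector \<Rightarrow> 'b::real_normed_vector"
  assumes "continuous_on UNIV f" and "\<And>t::real. t \<noteq> 0 \<Longrightarrow> f (t *\<^sub>R z) = 0"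
  shows "f 0 = 0"
proof -
  have "isCont (\<lambda>t::real. f (t *\<^sub>R z)) 0"
    by (intro continuous_on_interior[of UNIV] continuous_on_compose2[OF assms(1)] continuous_intros) auto
  then have "((\<lambda>t::real. f (t *\<^sub>R z)) \<longlongrightarrow> f 0) (at 0)"
    by (simp add: isCont_def)
  moreover have "((\<lambda>t::real. f (t *\<^sub>R z)) \<longlongrightarrow> 0) (at 0)"
    by (rule tendsto_eventually) (use assms(2) in \<open>auto simp: eventually_at_filter\<close>)
  ultimately show ?thesis by (rule LIM_unique)
qed

lemma smooth_on_imp_continuous_on: "smooth_on S f \<Longrightarrow> continuous_on S f"
  unfolding smooth_on_def by (metis Ck_on.simps(1))

theorem lemma4p17:
  fixes u v :: "octonion \<times> octonion \<Rightarrow> octonion"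
  assumes "smooth_on UNIV u" and "smooth_on UNIV v"
  shows "tangent_to_leaves L_OH (\<lambda>p. (u p, v p)) \<longleftrightarrow>
    (\<forall>x y. u (x, y) \<cdot>\<^sub>O oct_cnj y + x \<cdot>\<^sub>O oct_cnj (v (x, y)) = 0
         \<and> x \<bullet> u (x, y) = 0 \<and> y \<bullet> v (x, y) = 0)"
    (is "?tangent \<longleftrightarrow> (\<forall>x y. ?eqs x y)")
proof
  assume tangent: ?tangent
  show "\<forall>x y. ?eqs x y"
  proof (intro allI)
    fix x y
    show "?eqs x y"
    proof (cases "(x, y) = (0, 0)")
      case True
      then show ?thesis by (simp add: oct_mult.zero_left oct_mult.zero_right)
    next
      case False
      obtain L where L: "L \<in> L_OH" "(x, y) \<in> L" using leaf_through_exists by blast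
      with tangent have "(u (x, y), v (x, y)) \<in> tangent_space L (x, y)"
        unfolding tangent_to_leaves_def by blast
      then show ?thesis using tangent_space_leaf_iff[OF L False] by blast
    qed
  qed
next
  assume eqs: "\<forall>x y. ?eqs x y"
  \<comment> \<open>The equations say nothing at the origin; there the field vanishes by continuity.\<close>
  obtain z :: octonion where z: "z \<noteq> 0"
    using that[of "axis 0 1"] by (simp add: axis_eq_0_iff)
  \<comment> \<open>On the axis \<open>x = 0\<close> the first equation loses its \<open>v\<close>
    term and forces \<open>u = 0\<close> away from the origin; on \<open>y = 0\<close> it forces
    \<open>v = 0\<close> in the same way.\<close>
  have "u (0, t *\<^sub>R z) = 0" if "t \<noteq> 0" for t
    using eqs[rule_format, of 0 "t *\<^sub>R z"] that z by (simp add: oct_mult.zero_left oct_mult_eq_0_iff)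
  then have u0: "u 0 = 0"
    using continuous_zero_along_ray[OF smooth_on_imp_continuous_on[OF assms(1)], of "(0, z)"] by simp
  have "v (t *\<^sub>R z, 0) = 0" if "t \<noteq> 0" for t
    using eqs[rule_format, of "t *\<^sub>R z" 0] that z by (simp add: oct_mult.zero_right oct_mult_eq_0_iff)
  then have v0: "v 0 = 0"
    using continuous_zero_along_ray[OF smooth_on_imp_continuous_on[OF assms(2)], of "(z, 0)"] by simp
  show ?tangent
    unfolding tangent_to_leaves_def
  proof (intro allI ballI impI)
    fix p L assume L: "L \<in> L_OH" "p \<in> L"
    show "(u p, v p) \<in> tangent_space L p"
    proof (cases "p = 0")
      case True
      with L have "L = {p}" using leaf_through_zero by (simp add: zero_prod_def)
      with True u0 v0 show ?thesis by (simp add: tangent_space_singleton zero_prod_def)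
    next
      case False
      obtain x y where "p = (x, y)" by (cases p)
      with L False eqs show ?thesis by (simp add: tangent_space_leaf_iff zero_prod_def)
    qed
  qed
qed

end
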